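(* For all integers $m\geq 2$ and $n\geq 1$, \[ |\mathrm{rSYT}(m,n)| \geq |\mathrm{rSYT}(m-1,n)| \left( \binom{n}{2} + 1 \right) .\] In particular, $|\mathrm{rSYT}(n,n)| \geq n^{4n-o(n)}$ as $n\to\infty$.
   Context: For positive integers $m,n$, an $m\times n$ (rectangular) standard Young tableau is a bijection $T:[m]\times[n]\to\{1,\dots,mn\}$ that is increasing along rows and columns: $T(i,j)<T(i,j+1)$ and $T(i,j)<T(i+1,j)$ whenever defined. A vector $x\in\mathbb{R}^k$ is increasing if $x_1<x_2<\dots<x_k$. For increasing $x\in\mathbb{R}^m$, $y\in\mathbb{R}^n$ such that the $mn$ numbers $x_i+y_j$ are pairwise distinct, let $\mathcal T(x\circ y)$ be the tableau whose $(i,j)$ entry is the rank of $x_i+y_j$ among these $mn$ numbers (rank $1$ = smallest). A tableau is realizable if it equals $\mathcal T(x\circ y)$ for some such $x,y$. $\mathrm{rSYT}(m,n)$ denotes the set of realizable $m\times n$ standard Young tableaux. *)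

theory Defs
  imports Complex_Main "HOL-Library.FuncSet" "HOL-Library.Landau_Symbols"
begin

definition grid :: "nat \<Rightarrow> nat \<Rightarrow> (nat \<times> nat) set" where
  "grid m n = {1..m} \<times> {1..n}"

text \<open>
  Tableaux are functions on the grid. They are taken to be \<^const>\<open>extensional\<close>
  so that functions differing only outside the grid are not counted separately.
\<close>

definition SYT :: "nat \<Rightarrow> nat \<Rightarrow> (nat \<times> nat \<Rightarrow> nat) set" where
  "SYT m n = {T \<in> extensional (grid m n).
     bij_betw T (grid m n) {1..m * n} \<and>
     (\<forall>i j. (i, j) \<in> grid m n \<and> (i, j + 1) \<in> grid m n \<longrightarrow> T (i, j) < T (i, j + 1)) \<and>
     (\<forall>i j. (i, j) \<in> grid m n \<and> (i + 1, j) \<in> grid m n \<longrightarrow> T (i, j) < T (i + 1, j))}"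

text \<open>
  A vector in \<open>\<real>\<^sup>k\<close> is a function \<^typ>\<open>nat \<Rightarrow> real\<close> of which only the values
  on \<open>{1..k}\<close> are used.
\<close>

definition increasing_vec :: "nat \<Rightarrow> (nat \<Rightarrow> real) \<Rightarrow> bool" where
  "increasing_vec k x \<longleftrightarrow> strict_mono_on {1..k} x"

definition pair_sum :: "(nat \<Rightarrow> real) \<Rightarrow> (nat \<Rightarrow> real) \<Rightarrow> nat \<times> nat \<Rightarrow> real" where
  "pair_sum x y = (\<lambda>(i, j). x i + y j)"

definition rank_in :: "real set \<Rightarrow> real \<Rightarrow> nat" where
  "rank_in A a = card {b \<in> A. b \<le> a}"

definition sum_tableau ::
  "nat \<Rightarrow> nat \<Rightarrow> (nat \<Rightarrow> real) \<Rightarrow> (nat \<Rightarrow> real) \<Rightarrow> nat \<times> nat \<Rightarrow> nat" where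
  "sum_tableau m n x y =
     (\<lambda>p \<in> grid m n. rank_in (pair_sum x y ` grid m n) (pair_sum x y p))"

definition realizable :: "nat \<Rightarrow> nat \<Rightarrow> (nat \<times> nat \<Rightarrow> nat) \<Rightarrow> bool" where
  "realizable m n T \<longleftrightarrow>
     (\<exists>x y. increasing_vec m x \<and> increasing_vec n y \<and>
            inj_on (pair_sum x y) (grid m n) \<and> T = sum_tableau m n x y)"

definition rSYT :: "nat \<Rightarrow> nat \<Rightarrow> (nat \<times> nat \<Rightarrow> nat) set" where
  "rSYT m n = {T \<in> SYT m n. realizable m n T}"

lemma finite_SYT: "finite (SYT m n)"
proof -
  have "SYT m n \<subseteq> PiE (grid m n) (\<lambda>_. {1..m * n})"
    by (auto simp: SYT_def PiE_def bij_betw_def)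
  moreover have "finite (PiE (grid m n) (\<lambda>_. {1..m * n}))"
    by (intro finite_PiE) (auto simp: grid_def)
  ultimately show ?thesis
    by (rule finite_subset)
qed

lemma finite_rSYT: "finite (rSYT m n)"
  by (rule finite_subset[OF _ finite_SYT]) (auto simp: rSYT_def)

end

theory Submission
  imports Defs "HOL-Real_Asymp.Real_Asymp"
begin

text \<open>
  Let \<open>(x, y)\<close> realize an \<open>m \<times> n\<close> tableau, perturbed so that the differences
  \<open>y\<^sub>k - y\<^sub>j\<close> with \<open>j < k\<close> are pairwise distinct. Appending a coordinate
  \<open>x\<^sub>m + d\<close> to \<open>x\<close>, with \<open>d > 0\<close> generic, does not affect the order of the old sums, while
  the number of pairs \<open>j < k\<close> with \<open>x\<^sub>m + y\<^sub>k < (x\<^sub>m + d) + y\<^sub>j\<close> is the number of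
  differences below \<open>d\<close>, which takes all of the \<open>(n choose 2) + 1\<close> possible values. This number
  can be read off the new tableau. For the asymptotic bound, transposition allows rows and
  columns to be added alternately, which gives roughly
  \<open>(\<Prod>k\<le>n. k\<^sup>2 / 2)\<^sup>2 = n!\<^sup>4 / 4\<^sup>n\<close>.
\<close>

section \<open>Realizing pairs and the order of tableau entries\<close>

definition realizing :: "nat \<Rightarrow> nat \<Rightarrow> (nat \<Rightarrow> real) \<Rightarrow> (nat \<Rightarrow> real) \<Rightarrow> bool" where
  "realizing m n x y \<longleftrightarrow>
     increasing_vec m x \<and> increasing_vec n y \<and> inj_on (pair_sum x y) (grid m n)"

lemma finite_grid [simp]: "finite (grid m n)"
  by (simp add: grid_def)

lemma card_grid [simp]: "card (grid m n) = m * n"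
  by (simp add: grid_def card_cartesian_product)

text \<open>Injectivity turns a rank among values into a count of cells. Hence two pairs of vectors
  that order the cells in the same way have the same tableau.\<close>

lemma sum_tableau_conv_card:
  assumes "inj_on (pair_sum x y) (grid m n)" "p \<in> grid m n"
  shows "sum_tableau m n x y p = card {q \<in> grid m n. pair_sum x y q \<le> pair_sum x y p}"
proof -
  have "{b \<in> pair_sum x y ` grid m n. b \<le> pair_sum x y p}
      = pair_sum x y ` {q \<in> grid m n. pair_sum x y q \<le> pair_sum x y p}"
    by auto
  moreover have "inj_on (pair_sum x y) {q \<in> grid m n. pair_sum x y q \<le> pair_sum x y p}"
    by (rule inj_on_subset[OF assms(1)]) auto
  ultimately show ?thesis
    using assms(2) by (simp add: sum_tableau_def rank_in_def card_image)
qed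

lemma sum_tableau_le_iff:
  assumes "inj_on (pair_sum x y) (grid m n)" "p \<in> grid m n" "q \<in> grid m n"
  shows "sum_tableau m n x y p \<le> sum_tableau m n x y q \<longleftrightarrow> pair_sum x y p \<le> pair_sum x y q"
proof (cases "pair_sum x y p \<le> pair_sum x y q")
  case True
  then have "{r \<in> grid m n. pair_sum x y r \<le> pair_sum x y p}
      \<subseteq> {r \<in> grid m n. pair_sum x y r \<le> pair_sum x y q}"
    by auto
  then show ?thesis
    using True assms by (simp add: sum_tableau_conv_card card_mono)
next
  case False
  then have "{r \<in> grid m n. pair_sum x y r \<le> pair_sum x y q}
      \<subset> {r \<in> grid m n. pair_sum x y r \<le> pair_sum x y p}"
    using assms by force
  then have "card {r \<in> grid m n. pair_sum x y r \<le> pair_sum x y q}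
      < card {r \<in> grid m n. pair_sum x y r \<le> pair_sum x y p}"
    by (intro psubset_card_mono) auto
  then show ?thesis
    using False assms by (simp add: sum_tableau_conv_card)
qed

lemma sum_tableau_less_iff:
  assumes "inj_on (pair_sum x y) (grid m n)" "p \<in> grid m n" "q \<in> grid m n"
  shows "sum_tableau m n x y p < sum_tableau m n x y q \<longleftrightarrow> pair_sum x y p < pair_sum x y q"
  using sum_tableau_le_iff[OF assms(1,3,2)] by (simp add: not_le[symmetric])

text \<open>Ranks reflect the order of the sums, so they inherit monotonicity from \<open>x\<close>
  and \<open>y\<close>. They are \<open>m * n\<close> distinct values in \<open>{1..m * n}\<close>
  and therefore exhaust it.\<close>

lemma sum_tableau_in_SYT:
  assumes "realizing m n x y"
  shows "sum_tableau m n x y \<in> SYT m n"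
proof -
  let ?T = "sum_tableau m n x y"
  have inj: "inj_on (pair_sum x y) (grid m n)"
    and mono: "strict_mono_on {1..m} x" "strict_mono_on {1..n} y"
    using assms by (auto simp: realizing_def increasing_vec_def)
  have injT: "inj_on ?T (grid m n)"
  proof (rule inj_onI)
    fix p q assume pq: "p \<in> grid m n" "q \<in> grid m n" "?T p = ?T q"
    then have "pair_sum x y p = pair_sum x y q"
      using sum_tableau_le_iff[OF inj pq(1,2)] sum_tableau_le_iff[OF inj pq(2,1)] by auto
    then show "p = q"
      using inj pq by (auto dest: inj_onD)
  qed
  have "?T ` grid m n \<subseteq> {1..m * n}"
  proof
    fix v assume "v \<in> ?T ` grid m n"
    then obtain p where p: "p \<in> grid m n" "v = ?T p" by auto
    let ?A = "{q \<in> grid m n. pair_sum x y q \<le> pair_sum x y p}"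
    have "card ?A \<le> card (grid m n)"
      by (rule card_mono) auto
    moreover have "p \<in> ?A" "finite ?A"
      using p by auto
    then have "card ?A > 0"
      using card_gt_0_iff by blast
    ultimately show "v \<in> {1..m * n}"
      using p inj by (simp add: sum_tableau_conv_card)
  qed
  then have "?T ` grid m n = {1..m * n}"
    by (intro card_subset_eq) (auto simp: card_image[OF injT])
  moreover have "?T (i, j) < ?T (i, j + 1)"
    if "(i, j) \<in> grid m n" "(i, j + 1) \<in> grid m n" for i j
    using that mono(2)
    by (simp add: sum_tableau_less_iff[OF inj]) (auto simp: pair_sum_def grid_def strict_mono_on_def)
  moreover have "?T (i, j) < ?T (i + 1, j)"
    if "(i, j) \<in> grid m n" "(i + 1, j) \<in> grid m n" for i j
    using that mono(1)
    by (simp add: sum_tableau_less_iff[OF inj]) (auto simp: pair_sum_def grid_def strict_mono_on_def)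
  moreover have "?T \<in> extensional (grid m n)"
    by (simp add: sum_tableau_def)
  ultimately show ?thesis
    using injT by (simp add: SYT_def bij_betw_def)
qed

lemma rSYT_iff: "T \<in> rSYT m n \<longleftrightarrow> (\<exists>x y. realizing m n x y \<and> T = sum_tableau m n x y)"
  using sum_tableau_in_SYT by (auto simp: rSYT_def realizable_def realizing_def)

section \<open>Perturbation to pairwise distinct differences\<close>

text \<open>For \<open>j < k\<close> the difference \<open>2 ^ k - 2 ^ j\<close> lies in the
  interval from \<open>2 ^ (k - 1)\<close> (included) to \<open>2 ^ k\<close> (excluded), so it
  determines \<open>k\<close>, and then \<open>j\<close>.\<close>

lemma pow2_diff_inj:
  fixes j k j' k' :: nat
  assumes "j < k" "j' < k'" "(2::real) ^ k - 2 ^ j = 2 ^ k' - 2 ^ j'"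
  shows "j = j' \<and> k = k'"
proof -
  have less: "(2::real) ^ b - 2 ^ a < 2 ^ d - 2 ^ c" if "b < d" "c < d" for a b c d :: nat
  proof -
    obtain e where d: "d = Suc e" using \<open>b < d\<close> by (cases d) auto
    have "(2::real) ^ b \<le> 2 ^ e" "(2::real) ^ c \<le> 2 ^ e"
      using that d by auto
    moreover have "(2::real) ^ a > 0" by simp
    ultimately show ?thesis
      unfolding d power_Suc by linarith
  qed
  have "k = k'"
    using less[of k k' j' j] less[of k' k j j'] assms by (cases k k' rule: linorder_cases) auto
  then show ?thesis
    using assms by simp
qed

lemma eventually_perturb_pos:
  fixes a b :: real
  assumes "a > 0"
  shows "\<forall>\<^sub>F e in at_right 0. a + e * b > 0"
proof -
  have "((\<lambda>e. a + e * b) \<longlongrightarrow> a + 0 * b) (at_right 0)"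
    by (intro tendsto_intros)
  then show ?thesis
    using assms by (auto dest: order_tendstoD)
qed

text \<open>If \<open>a\<close> is nonzero, its sign persists for small \<open>e\<close>. If
  \<open>a = 0\<close>, the value is \<open>e * b\<close>, which is nonzero because
  \<open>at_right 0\<close> only sees \<open>e > 0\<close>.\<close>

lemma eventually_perturb_nonzero:
  fixes a b :: real
  assumes "a \<noteq> 0 \<or> b \<noteq> 0"
  shows "\<forall>\<^sub>F e in at_right 0. a + e * b \<noteq> 0"
proof (cases a "0::real" rule: linorder_cases)
  case less
  then show ?thesis
    using eventually_perturb_pos[of "- a" "- b"] by (auto elim!: eventually_mono)
next
  case equal
  then show ?thesis
    using assms by (auto intro: eventually_mono[OF eventually_at_right_less])
next
  case greater
  then show ?thesis
    using eventually_perturb_pos[of a b] by (auto elim!: eventually_mono)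
qed

definition index_pairs :: "nat \<Rightarrow> (nat \<times> nat) set" where
  "index_pairs n = {(j, k). 1 \<le> j \<and> j < k \<and> k \<le> n}"

lemma finite_index_pairs [simp]: "finite (index_pairs n)"
proof (rule finite_subset)
  show "index_pairs n \<subseteq> {1..n} \<times> {1..n}"
    by (auto simp: index_pairs_def)
qed simp

lemma card_index_pairs: "card (index_pairs n) = n choose 2"
proof (induction n)
  case 0
  have "index_pairs 0 = {}" by (auto simp: index_pairs_def)
  then show ?case by simp
next
  case (Suc n)
  have "index_pairs (Suc n) = index_pairs n \<union> (\<lambda>j. (j, Suc n)) ` {1..n}"
    by (auto simp: index_pairs_def le_Suc_eq image_iff)
  moreover have "card (index_pairs n \<union> (\<lambda>j. (j, Suc n)) ` {1..n})
      = card (index_pairs n) + card ((\<lambda>j. (j, Suc n)) ` {1..n})"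
    by (rule card_Un_disjoint) (simp_all, auto simp: index_pairs_def)
  moreover have "card ((\<lambda>j. (j, Suc n)) ` {1..n}) = n"
    by (subst card_image) (auto simp: inj_on_def)
  ultimately show ?case
    using Suc.IH by (simp add: numeral_2_eq_2)
qed

definition pair_diff :: "(nat \<Rightarrow> real) \<Rightarrow> nat \<times> nat \<Rightarrow> real" where
  "pair_diff y = (\<lambda>(j, k). y k - y j)"

text \<open>A small perturbation of \<open>y\<close> keeps every strict comparison between sums,
  hence the tableau, and can separate all differences. Distinct differences are what later lets the
  shift of a new row increase in steps of one.\<close>

lemma rSYT_generic:
  assumes "T \<in> rSYT m n"
  obtains x y where "realizing m n x y" "T = sum_tableau m n x y" "inj_on (pair_diff y) (index_pairs n)"
proof -
  obtain x y where xy: "realizing m n x y" "T = sum_tableau m n x y"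
    using assms by (auto simp: rSYT_iff)
  have inj: "inj_on (pair_sum x y) (grid m n)"
    using xy by (simp add: realizing_def)
  \<comment> \<open>The weights \<open>2 ^ j\<close> increase with \<open>j\<close>, so
    \<open>z e\<close> stays increasing for \<open>e > 0\<close>, and their differences are pairwise
    distinct by \<open>pow2_diff_inj\<close>.\<close>
  define z where "z e j = y j + e * 2 ^ j" for e :: real and j :: nat
  \<comment> \<open>Only finitely many conditions have to be met, so a single small \<open>e\<close>
    serves them all.\<close>
  let ?S = "{(p, q) \<in> grid m n \<times> grid m n. pair_sum x y p < pair_sum x y q}"
  let ?D = "{(p, q) \<in> index_pairs n \<times> index_pairs n. p \<noteq> q}"
  have fin: "finite ?S" "finite ?D"
    by (auto intro: finite_subset[of _ "grid m n \<times> grid m n"]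
                    finite_subset[of _ "index_pairs n \<times> index_pairs n"])
  have 1: "\<forall>\<^sub>F e in at_right 0. \<forall>(p, q)\<in>?S. pair_sum x (z e) p < pair_sum x (z e) q"
  proof (rule eventually_ball_finite[OF fin(1)], clarify)
    fix i j k l assume "pair_sum x y (i, j) < pair_sum x y (k, l)"
    then have "x k + y l - (x i + y j) > 0" by (simp add: pair_sum_def)
    from eventually_perturb_pos[OF this, of "2 ^ l - 2 ^ j"]
    show "\<forall>\<^sub>F e in at_right 0. pair_sum x (z e) (i, j) < pair_sum x (z e) (k, l)"
      by eventually_elim (simp add: pair_sum_def z_def algebra_simps)
  qed
  have 2: "\<forall>\<^sub>F e in at_right 0. \<forall>(p, q)\<in>?D. pair_diff (z e) p \<noteq> pair_diff (z e) q"
  proof (rule eventually_ball_finite[OF fin(2)], rule ballI)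
    fix pq assume "pq \<in> ?D"
    then obtain j k j' k' where pq: "pq = ((j, k), (j', k'))"
      and *: "(j, k) \<in> index_pairs n" "(j', k') \<in> index_pairs n" "(j, k) \<noteq> (j', k')"
      by auto
    \<comment> \<open>Even if the two differences of \<open>y\<close> coincide, the slopes in
      \<open>e\<close> differ, so the perturbed differences separate.\<close>
    from * have "(2::real) ^ k - 2 ^ j - (2 ^ k' - 2 ^ j') \<noteq> 0"
      using pow2_diff_inj[of j k j' k'] by (auto simp: index_pairs_def)
    then have "\<forall>\<^sub>F e in at_right 0. y k - y j - (y k' - y j')
        + e * (2 ^ k - 2 ^ j - (2 ^ k' - 2 ^ j')) \<noteq> 0"
      by (intro eventually_perturb_nonzero) simp
    then show "\<forall>\<^sub>F e in at_right 0. case pq of (p, q) \<Rightarrow> pair_diff (z e) p \<noteq> pair_diff (z e) q"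
      by eventually_elim (simp add: pq pair_diff_def z_def algebra_simps)
  qed
  have "\<forall>\<^sub>F e in at_right (0::real). e > 0"
    by (rule eventually_at_right_less)
  with 1 2 have "\<forall>\<^sub>F e in at_right 0. e > 0 \<and>
      (\<forall>(p, q)\<in>?S. pair_sum x (z e) p < pair_sum x (z e) q) \<and>
      (\<forall>(p, q)\<in>?D. pair_diff (z e) p \<noteq> pair_diff (z e) q)"
    by eventually_elim blast
  then obtain e where e: "e > 0"
      "\<forall>(p, q)\<in>?S. pair_sum x (z e) p < pair_sum x (z e) q"
      "\<forall>(p, q)\<in>?D. pair_diff (z e) p \<noteq> pair_diff (z e) q"
    using eventually_happens'[OF trivial_limit_at_right_real] by blast
  have le_iff: "pair_sum x (z e) p \<le> pair_sum x (z e) q \<longleftrightarrow> pair_sum x y p \<le> pair_sum x y q"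
    if "p \<in> grid m n" "q \<in> grid m n" for p q
  proof (cases "pair_sum x y p" "pair_sum x y q" rule: linorder_cases)
    case less
    then have "(p, q) \<in> ?S" using that by simp
    then have "pair_sum x (z e) p < pair_sum x (z e) q" using e(2) by blast
    then show ?thesis using less by simp
  next
    case equal
    then have "p = q" using that inj by (simp add: inj_onD)
    then show ?thesis by simp
  next
    case greater
    then have "(q, p) \<in> ?S" using that by simp
    then have "pair_sum x (z e) q < pair_sum x (z e) p" using e(2) by blast
    then show ?thesis using greater by simp
  qed
  have inj': "inj_on (pair_sum x (z e)) (grid m n)"
  proof (rule inj_onI)
    fix p q assume pq: "p \<in> grid m n" "q \<in> grid m n" "pair_sum x (z e) p = pair_sum x (z e) q"
    then have "pair_sum x y p = pair_sum x y q"
      using le_iff[of p q] le_iff[of q p] by auto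
    then show "p = q" using inj pq by (auto dest: inj_onD)
  qed
  have "increasing_vec n (z e)"
    using xy(1) e(1) unfolding realizing_def increasing_vec_def strict_mono_on_def z_def
    by (auto intro!: add_strict_mono)
  then have "realizing m n x (z e)"
    using xy(1) inj' by (simp add: realizing_def)
  moreover have "T = sum_tableau m n x (z e)"
  proof
    fix p show "T p = sum_tableau m n x (z e) p"
    proof (cases "p \<in> grid m n")
      case True
      then have "{q \<in> grid m n. pair_sum x (z e) q \<le> pair_sum x (z e) p}
          = {q \<in> grid m n. pair_sum x y q \<le> pair_sum x y p}"
        using le_iff by blast
      then show ?thesis
        using True by (simp add: xy(2) sum_tableau_conv_card inj inj')
    next
      case False
      then show ?thesis by (simp add: xy(2) sum_tableau_def)
    qed
  qed
  moreover have "inj_on (pair_diff (z e)) (index_pairs n)"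
  proof (rule inj_onI, rule ccontr)
    fix p q assume "p \<in> index_pairs n" "q \<in> index_pairs n"
      "pair_diff (z e) p = pair_diff (z e) q" "p \<noteq> q"
    moreover from this have "(p, q) \<in> ?D" by simp
    ultimately show False using e(3) by blast
  qed
  ultimately show ?thesis by (rule that)
qed

section \<open>Appending a row with a prescribed shift\<close>

text \<open>Each gap between consecutive elements of \<open>D\<close> is an open interval, hence
  infinite, and leaves room to avoid the finite set \<open>B\<close>. The induction adds elements
  below all earlier ones; the lower bound \<open>l\<close> is generalized so that the search can
  restart above the new minimum.\<close>

lemma exists_cut:
  fixes D B :: "real set" and l :: real
  assumes "finite D" "finite B" "\<forall>a\<in>D. l < a" "c \<le> card D"
  shows "\<exists>d>l. d \<notin> B \<and> card {a \<in> D. a < d} = c"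
  using assms(1,3,4)
proof (induction D arbitrary: l c rule: finite_linorder_min_induct)
  case empty
  have "infinite ({l<..} - B)"
    using assms(2) by (simp add: infinite_Ioi)
  then obtain d where "d \<in> {l<..} - B"
    using infinite_imp_nonempty by blast
  then show ?case using empty by auto
next
  case (insert b D)
  show ?case
  proof (cases c)
    case 0
    have "infinite ({l<..<b} - B)"
      using assms(2) insert.prems by (simp add: infinite_Ioo)
    then obtain d where d: "d \<in> {l<..<b} - B"
      using infinite_imp_nonempty by blast
    then have "{a \<in> insert b D. a < d} = {}"
      using insert.hyps by force
    then have "card {a \<in> insert b D. a < d} = 0"
      by (simp only: card.empty)
    then show ?thesis using d 0 by auto
  next
    case (Suc c')
    have "b \<notin> D" using insert.hyps by blast
    \<comment> \<open>The search restarts above the minimum \<open>b\<close>, which itself accounts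
      for one of the \<open>c\<close> elements below \<open>d\<close>.\<close>
    then obtain d where d: "d > b" "d \<notin> B" "card {a \<in> D. a < d} = c'"
      using insert.IH[of b c'] insert.hyps insert.prems Suc by auto
    have "{a \<in> insert b D. a < d} = insert b {a \<in> D. a < d}"
      using d by auto
    then have "card {a \<in> insert b D. a < d} = c"
      using d \<open>b \<notin> D\<close> insert.hyps Suc by simp
    then show ?thesis
      using d insert.prems by (intro exI[of _ d]) auto
  qed
qed

text \<open>The standardization of the first \<open>m\<close> rows. It refers to the tableau only,
  not to a realizing pair, and so is a map on tableaux.\<close>

definition drop_last_row :: "nat \<Rightarrow> nat \<Rightarrow> (nat \<times> nat \<Rightarrow> nat) \<Rightarrow> nat \<times> nat \<Rightarrow> nat" where
  "drop_last_row m n T = (\<lambda>p \<in> grid m n. card {q \<in> grid m n. T q \<le> T p})"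

text \<open>Here \<open>T\<close> has \<open>Suc m\<close> rows. If the last two coordinates of a
  realizing \<open>x\<close> differ by \<open>d\<close>, the condition says that
  \<open>y k - y j < d\<close>, so this counts the differences below \<open>d\<close>.\<close>

definition last_row_shift :: "nat \<Rightarrow> nat \<Rightarrow> (nat \<times> nat \<Rightarrow> nat) \<Rightarrow> nat" where
  "last_row_shift m n T = card {(j, k) \<in> index_pairs n. T (m, k) < T (Suc m, j)}"

text \<open>The old tableau and the shift can be prescribed independently: appending the coordinate
  \<open>x m + d\<close> leaves the order of the old sums alone, while the choice of
  \<open>d\<close> controls the shift.\<close>

lemma extend_tableau:
  assumes "m \<ge> 1" "T \<in> rSYT m n" "c \<le> n choose 2"
  shows "\<exists>U \<in> rSYT (Suc m) n. drop_last_row m n U = T \<and> last_row_shift m n U = c"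
proof -
  obtain x y where xy: "realizing m n x y" "T = sum_tableau m n x y"
    and injD: "inj_on (pair_diff y) (index_pairs n)"
    using rSYT_generic[OF assms(2)] .
  have inj: "inj_on (pair_sum x y) (grid m n)"
    and mono: "strict_mono_on {1..m} x" "strict_mono_on {1..n} y"
    using xy by (auto simp: realizing_def increasing_vec_def)
  define D where "D = pair_diff y ` index_pairs n"
  \<comment> \<open>The forbidden values of \<open>d\<close>: those for which a new sum
    \<open>x m + d + y j\<close> would equal an old sum \<open>x i + y k\<close>.\<close>
  define B where "B = (\<lambda>(i, j, k). x i + y k - y j - x m) ` ({1..m} \<times> {1..n} \<times> {1..n})"
  have "\<forall>a\<in>D. 0 < a"
    using mono(2) by (auto simp: D_def pair_diff_def index_pairs_def strict_mono_on_def)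
  moreover have "c \<le> card D"
    using assms(3) by (simp add: D_def card_image[OF injD] card_index_pairs)
  ultimately obtain d where d: "d > 0" "d \<notin> B" "card {a \<in> D. a < d} = c"
    using exists_cut[of D B 0 c] by (auto simp: D_def B_def)
  define x' where "x' = x(Suc m := x m + d)"
  have x'_old: "pair_sum x' y p = pair_sum x y p" if "p \<in> grid m n" for p
    using that by (auto simp: pair_sum_def x'_def grid_def)
  have sub: "grid m n \<subseteq> grid (Suc m) n"
    by (auto simp: grid_def)
  have new: "x' (Suc m) + y j \<noteq> x' i + y k" if "i \<in> {1..m}" "j \<in> {1..n}" "k \<in> {1..n}" for i j k
  proof
    assume "x' (Suc m) + y j = x' i + y k"
    then have "d = x i + y k - y j - x m"
      using that by (simp add: x'_def)
    then show False
      using d(2) that by (force simp: B_def)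
  qed
  have injy: "inj_on y {1..n}"
    using mono(2) by (rule strict_mono_on_imp_inj_on)
  have inj': "inj_on (pair_sum x' y) (grid (Suc m) n)"
  proof (rule inj_onI, clarify)
    fix i j k l
    assume *: "(i, j) \<in> grid (Suc m) n" "(k, l) \<in> grid (Suc m) n"
      "pair_sum x' y (i, j) = pair_sum x' y (k, l)"
    then have **: "x' i + y j = x' k + y l" "j \<in> {1..n}" "l \<in> {1..n}"
      by (auto simp: pair_sum_def grid_def)
    consider "i \<in> {1..m}" "k \<in> {1..m}" | "i = Suc m" "k \<in> {1..m}" | "i \<in> {1..m}" "k = Suc m"
      | "i = Suc m" "k = Suc m"
      using * by (fastforce simp: grid_def le_Suc_eq)
    then show "i = k \<and> j = l"
    proof cases
      case 1
      then have "(i, j) \<in> grid m n" "(k, l) \<in> grid m n"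
        using ** by (auto simp: grid_def)
      then show ?thesis
        using *(3) inj x'_old by (auto dest: inj_onD)
    next
      case 2
      then show ?thesis using new[of k j l] ** by auto
    next
      case 3
      then show ?thesis using new[of i l j] ** by auto
    next
      case 4
      then show ?thesis using ** injy by (auto dest: inj_onD)
    qed
  qed
  have le_last: "x i \<le> x m" if "i \<in> {1..m}" for i
    using that mono(1) assms(1)
    by (cases "i = m") (auto simp: strict_mono_on_def intro!: less_imp_le)
  have "strict_mono_on {1..Suc m} x'"
  proof (rule strict_mono_onI)
    fix r s assume "r \<in> {1..Suc m}" "s \<in> {1..Suc m}" "r < s"
    then show "x' r < x' s"
      using mono(1) le_last[of r] d(1) by (cases "s = Suc m") (auto simp: x'_def strict_mono_on_def)
  qed
  then have real': "realizing (Suc m) n x' y"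
    using mono(2) inj' by (simp add: realizing_def increasing_vec_def)
  define U where "U = sum_tableau (Suc m) n x' y"
  have "U \<in> rSYT (Suc m) n"
    using real' by (auto simp: rSYT_iff U_def)
  moreover have "drop_last_row m n U = T"
  proof
    fix p show "drop_last_row m n U p = T p"
    proof (cases "p \<in> grid m n")
      case True
      have "U q \<le> U p \<longleftrightarrow> pair_sum x y q \<le> pair_sum x y p" if "q \<in> grid m n" for q
        using sum_tableau_le_iff[OF inj', of q p] sub that True by (auto simp: U_def x'_old)
      then have "{q \<in> grid m n. U q \<le> U p} = {q \<in> grid m n. pair_sum x y q \<le> pair_sum x y p}"
        by blast
      then show ?thesis
        using True by (simp add: xy(2) drop_last_row_def sum_tableau_conv_card inj)
    next
      case False
      then show ?thesis by (simp add: xy(2) drop_last_row_def sum_tableau_def)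
    qed
  qed
  moreover have "last_row_shift m n U = c"
  proof -
    have "U (m, k) < U (Suc m, j) \<longleftrightarrow> pair_diff y (j, k) < d" if "(j, k) \<in> index_pairs n" for j k
    proof -
      have "(m, k) \<in> grid (Suc m) n" "(Suc m, j) \<in> grid (Suc m) n"
        using that assms(1) by (auto simp: grid_def index_pairs_def)
      then have "U (m, k) < U (Suc m, j) \<longleftrightarrow> pair_sum x' y (m, k) < pair_sum x' y (Suc m, j)"
        unfolding U_def by (rule sum_tableau_less_iff[OF inj'])
      then show ?thesis
        by (auto simp: pair_sum_def pair_diff_def x'_def)
    qed
    then have "{(j, k) \<in> index_pairs n. U (m, k) < U (Suc m, j)}
        = {p \<in> index_pairs n. pair_diff y p < d}"
      by auto
    moreover have "card {p \<in> index_pairs n. pair_diff y p < d}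
        = card (pair_diff y ` {p \<in> index_pairs n. pair_diff y p < d})"
      by (rule card_image[symmetric], rule inj_on_subset[OF injD]) auto
    moreover have "pair_diff y ` {p \<in> index_pairs n. pair_diff y p < d} = {a \<in> D. a < d}"
      by (auto simp: D_def)
    ultimately show ?thesis
      using d(3) by (simp add: last_row_shift_def)
  qed
  ultimately show ?thesis by blast
qed

text \<open>Deleting the last row while recording its shift maps onto all pairs of a smaller tableau
  and a number in \<open>{..n choose 2}\<close>, a set of \<open>(n choose 2) + 1\<close>
  elements.\<close>

lemma card_rSYT_Suc:
  assumes "m \<ge> 1"
  shows "card (rSYT m n) * ((n choose 2) + 1) \<le> card (rSYT (Suc m) n)"
proof -
  have "rSYT m n \<times> {..n choose 2}
      \<subseteq> (\<lambda>U. (drop_last_row m n U, last_row_shift m n U)) ` rSYT (Suc m) n"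
    using extend_tableau[OF assms] by fastforce
  then have "card (rSYT m n \<times> {..n choose 2}) \<le> card (rSYT (Suc m) n)"
    by (rule surj_card_le[OF finite_rSYT])
  then show ?thesis by (simp add: card_cartesian_product)
qed

section \<open>Transposition and growth of square tableaux\<close>

text \<open>Exchanging \<open>x\<close> and \<open>y\<close> transposes the tableau, so every
  tableau on the left is the transpose of one on the right. Equality follows by exchanging
  \<open>m\<close> and \<open>n\<close>.\<close>

lemma card_rSYT_transpose_le: "card (rSYT m n) \<le> card (rSYT n m)"
proof -
  let ?t = "\<lambda>T. restrict (T \<circ> prod.swap) (grid m n)"
  have "rSYT m n \<subseteq> ?t ` rSYT n m"
  proof
    fix T assume "T \<in> rSYT m n"
    then obtain x y where xy: "realizing m n x y" "T = sum_tableau m n x y"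
      by (auto simp: rSYT_iff)
    have swap: "pair_sum y x = pair_sum x y \<circ> prod.swap"
      by (auto simp: pair_sum_def)
    have grid: "grid n m = prod.swap ` grid m n"
      by (auto simp: grid_def)
    have image: "pair_sum y x ` grid n m = pair_sum x y ` grid m n"
      by (simp add: swap grid image_image)
    have "inj_on (pair_sum y x) (grid n m)"
      using xy(1) unfolding swap grid realizing_def
      by (intro comp_inj_on) (auto simp: image_image)
    then have "sum_tableau n m y x \<in> rSYT n m"
      using xy(1) by (auto simp: rSYT_iff realizing_def)
    moreover have "T = ?t (sum_tableau n m y x)"
      unfolding xy(2) sum_tableau_def image
      by (auto simp: restrict_def fun_eq_iff swap grid)
    ultimately show "T \<in> ?t ` rSYT n m" by blast
  qed
  then show ?thesis
    by (rule surj_card_le[OF finite_rSYT])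
qed

lemma card_rSYT_transpose: "card (rSYT m n) = card (rSYT n m)"
  by (intro antisym card_rSYT_transpose_le)

lemma real_choose_two: "real (n choose 2) = real n * (real n - 1) / 2"
  by (induction n) (auto simp: numeral_2_eq_2 field_simps)

text \<open>One row is added to the square, the result is transposed, and another row of length
  \<open>Suc n\<close> is added. The constant is \<open>32 = 8 * 4\<close>, from crude bounds on the
  two factors.\<close>

lemma card_rSYT_square_step:
  assumes "n \<ge> 1"
  shows "real (card (rSYT n n)) * (real (Suc n) ^ 4 / 32) \<le> real (card (rSYT (Suc n) (Suc n)))"
proof -
  have "card (rSYT n n) * ((n choose 2) + 1) * ((Suc n choose 2) + 1)
      \<le> card (rSYT (Suc n) n) * ((Suc n choose 2) + 1)"
    by (rule mult_right_mono[OF card_rSYT_Suc[OF assms]]) simp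
  also have "\<dots> = card (rSYT n (Suc n)) * ((Suc n choose 2) + 1)"
    by (simp add: card_rSYT_transpose)
  also have "\<dots> \<le> card (rSYT (Suc n) (Suc n))"
    by (rule card_rSYT_Suc[OF assms])
  finally have main: "real (card (rSYT n n)) * ((real (n choose 2) + 1) * (real (Suc n choose 2) + 1))
      \<le> real (card (rSYT (Suc n) (Suc n)))"
    by (simp flip: of_nat_le_iff[where 'a = real] add: algebra_simps)
  define t where "t = real (Suc n)"
  \<comment> \<open>Multiplied by 8, right side minus left side is
    \<open>3 * (t - 2) ^ 2 + 4\<close>; for the next bound, multiplied by 4, it is
    \<open>(t - 1) ^ 2 + 3\<close>.\<close>
  have "t ^ 2 / 8 \<le> real (n choose 2) + 1"
    using zero_le_power2[of "t - 2"]
    by (simp add: real_choose_two t_def power2_eq_square field_simps)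
  moreover have "t ^ 2 / 4 \<le> real (Suc n choose 2) + 1"
    using zero_le_power2[of "t - 1"]
    by (simp add: real_choose_two t_def power2_eq_square field_simps)
  ultimately have "t ^ 2 / 8 * (t ^ 2 / 4) \<le> (real (n choose 2) + 1) * (real (Suc n choose 2) + 1)"
    by (intro mult_mono) auto
  moreover have "t ^ 2 / 8 * (t ^ 2 / 4) = t ^ 4 / 32"
    by (simp add: power_def numeral_eq_Suc)
  ultimately have "real (card (rSYT n n)) * (t ^ 4 / 32)
      \<le> real (card (rSYT n n)) * ((real (n choose 2) + 1) * (real (Suc n choose 2) + 1))"
    by (intro mult_left_mono) auto
  with main show ?thesis by (simp add: t_def)
qed

text \<open>The step is iterated from the \<open>1 \<times> 1\<close> case. The base
  \<open>32\<close> in place of \<open>4\<close> costs only a factor exponential in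
  \<open>n\<close>, which the error term absorbs.\<close>

lemma card_rSYT_square_ge_fact:
  assumes "n \<ge> 1"
  shows "fact n ^ 4 / 32 ^ n \<le> real (card (rSYT n n))"
  using assms
proof (induction n rule: dec_induct)
  case base
  have "realizing 1 1 (\<lambda>_. 0) (\<lambda>_. 0)"
    by (auto simp: realizing_def increasing_vec_def grid_def strict_mono_on_def)
  then have "rSYT 1 1 \<noteq> {}"
    using rSYT_iff by blast
  then have "card (rSYT 1 1) \<ge> 1"
    using finite_rSYT by (simp add: Suc_le_eq card_gt_0_iff)
  then show ?case by simp
next
  case (step n)
  have "fact (Suc n) ^ 4 / 32 ^ Suc n = fact n ^ 4 / 32 ^ n * (real (Suc n) ^ 4 / 32)"
    by (simp add: power_mult_distrib mult.commute del: of_nat_Suc)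
  also have "\<dots> \<le> real (card (rSYT n n)) * (real (Suc n) ^ 4 / 32)"
    by (rule mult_right_mono[OF step.IH]) simp
  also have "\<dots> \<le> real (card (rSYT (Suc n) (Suc n)))"
    by (rule card_rSYT_square_step[OF step.hyps(1)])
  finally show ?case .
qed

section \<open>The asymptotic bound\<close>

text \<open>A weak form of Stirling's bound: \<open>n ^ n / fact n\<close> is one term of the
  exponential series at \<open>n\<close>, and all terms are nonnegative.\<close>

lemma power_self_le_fact_exp: "real n ^ n \<le> fact n * exp (real n)"
proof -
  have "(\<Sum>k\<in>{n}. real n ^ k /\<^sub>R fact k) \<le> exp (real n)"
    unfolding exp_def by (rule sum_le_suminf[OF summable_exp_generic]) auto
  then show ?thesis by (simp add: field_simps)
qed

theorem theorem1p3:
  shows "(\<forall>m n. m \<ge> 2 \<and> n \<ge> 1 \<longrightarrow>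
            card (rSYT m n) \<ge> card (rSYT (m - 1) n) * ((n choose 2) + 1))
       \<and> (\<exists>e :: nat \<Rightarrow> real. e \<in> o(\<lambda>n. real n) \<and>
            (\<forall>\<^sub>F n in sequentially.
               real (card (rSYT n n)) \<ge> real n powr (4 * real n - e n)))"
proof (intro conjI allI impI)
  fix m n :: nat assume "m \<ge> 2 \<and> n \<ge> 1"
  then have "m - 1 \<ge> 1" "Suc (m - 1) = m"
    by auto
  then show "card (rSYT m n) \<ge> card (rSYT (m - 1) n) * ((n choose 2) + 1)"
    using card_rSYT_Suc[of "m - 1" n] by metis
next
  \<comment> \<open>Replacing \<open>fact n\<close> by \<open>(n / exp 1) ^ n\<close> in
    \<open>fact n ^ 4 / 32 ^ n\<close> gives \<open>exp (4 * n * ln n - C * n)\<close>. Writing this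
    as a power of \<open>n\<close> divides the loss \<open>C * n\<close> by \<open>ln n\<close>,
    which gives \<open>e n\<close>.\<close>
  define C :: real where "C = 4 + ln 32"
  define e where "e n = C * real n / ln (real n)" for n :: nat
  have "e \<in> o(\<lambda>n. real n)"
    unfolding e_def by real_asymp
  \<comment> \<open>From \<open>n = 2\<close> on, \<open>ln n\<close> is positive, so the division
    in \<open>e n\<close> cancels.\<close>
  moreover have "real n powr (4 * real n - e n) \<le> real (card (rSYT n n))" if "n \<ge> 2" for n
  proof -
    have ln: "ln (real n) > 0" using that by simp
    have "real n powr (4 * real n - e n) = exp (4 * real n * ln (real n) - C * real n)"
      using that ln by (simp add: powr_def e_def algebra_simps)
    also have "\<dots> = (real n ^ n) ^ 4 / (exp (real n) ^ 4 * 32 ^ n)"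
    proof -
      have "exp (4 * real n * ln (real n)) = (real n ^ n) ^ 4"
        using that by (simp add: exp_of_nat_mult exp_ln flip: power_mult)
          (metis exp_ln exp_of_nat_mult mult.commute of_nat_0_less_iff of_nat_mult of_nat_numeral
            pos2 order_less_le_trans)
      moreover have "exp (C * real n) = exp (real n) ^ 4 * 32 ^ n"
        by (simp add: C_def algebra_simps exp_add flip: exp_of_nat_mult)
          (simp add: exp_of_nat_mult)
      ultimately show ?thesis by (simp add: exp_diff)
    qed
    also have "\<dots> \<le> (fact n * exp (real n)) ^ 4 / (exp (real n) ^ 4 * 32 ^ n)"
      by (intro divide_right_mono power_mono power_self_le_fact_exp) auto
    also have "\<dots> = fact n ^ 4 / 32 ^ n"
      by (simp add: power_mult_distrib)
    also have "\<dots> \<le> real (card (rSYT n n))"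
      using that by (intro card_rSYT_square_ge_fact) simp
    finally show ?thesis .
  qed
  ultimately show "\<exists>e :: nat \<Rightarrow> real. e \<in> o(\<lambda>n. real n) \<and>
      (\<forall>\<^sub>F n in sequentially. real (card (rSYT n n)) \<ge> real n powr (4 * real n - e n))"
    by (intro exI[of _ e] conjI) (auto intro: eventually_sequentiallyI[of 2])
qed

end
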